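(* Let $\Omega\subset\mathbb{R}^n$ be compact and convex, $f\in C^1(\Omega)$ with $L$-Lipschitz gradient on $\Omega$ ($L>0$), and let $\mathcal{A}$ be a method satisfying the angle condition $\mathrm{SB}_{\mathcal A}(\Omega)=\tau>0$. Let $x_k$ and $x_{k+1}$ be consecutive iterates of the first-order method with directions $d_k\in\mathcal{A}(x_k,-\nabla f(x_k))$ and stepsize $\alpha_k=\min(\bar\alpha_k,\alpha_k^{\max})$, where $\bar\alpha_k=\frac{\langle-\nabla f(x_k),d_k\rangle}{L\|d_k\|^2}$. Let $\mu>0$ and let $x^*\in\Omega$ be a stationary point such that $$\pi_x(-\nabla f(x))\ \ge\ \sqrt{2\mu}\,(f(x)-f(x^* ))^{1/2}\qquad(\text{in particular } f(x)\ge f(x^* ))$$ holds for $x=x_k$ and $x=x_{k+1}$. (i) If $\alpha_k=\bar\alpha_k$, then $f(x_{k+1})-f(x^* )\le\left(1-\frac{\mu}{L}\tau^2\right)(f(x_k)-f(x^* ))$. (ii) If step $k$ is a full FW step, i.e. $x_{k+1}\in\arg\min_{x\in\Omega}\langle\nabla f(x_k),x\rangle$, then $f(x_{k+1})-f(x^* )\le\left(1+\frac{\mu}{L}\right)^{-1}(f(x_k)-f(x^* ))$.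
   Context: $\|\cdot\|$ is the Euclidean norm. $f\in C^1(\Omega)$ means continuously differentiable on an open set containing $\Omega$; the Lipschitz condition is $\|\nabla f(x)-\nabla f(y)\|\le L\|x-y\|$ for $x,y\in\Omega$. For $x\in\Omega$, $T_\Omega(x)=\mathrm{cl}\{w:\exists\lambda>0,\ x+\lambda w\in\Omega\}$ is the tangent cone, $\pi(C,\cdot)$ the Euclidean projection on a closed convex set $C$, and $\pi_x(g)=\|\pi(T_\Omega(x),g)\|$. A point $x$ is stationary if $\pi_x(-\nabla f(x))=0$. A method $\mathcal{A}$ assigns to every $(x,g)\in\Omega\times\mathbb{R}^n$ a set $\mathcal{A}(x,g)\subset (T_\Omega(x)\cap\{d:\langle g,d\rangle>0\})\cup\{0\}$ of feasible directions at $x$, with $\mathcal{A}(x,g)=\{0\}$ if $\pi_x(g)=0$ and $0\notin\mathcal{A}(x,g)\ne\emptyset$ otherwise. $\mathrm{DSB}_{\mathcal A}(\Omega,x,g)=\inf_{d\in\mathcal{A}(x,g)}\frac{\langle g,d\rangle}{\pi_x(g)\|d\|}$ if $\pi_x(g)\neq0$, and $=1$ if $\pi_x(g)=0$; $\mathrm{SB}_{\mathcal A}(\Omega)=\inf_{x\in\Omega,g\in\mathbb{R}^n}\mathrm{DSB}_{\mathcal A}(\Omega,x,g)$. First-order method: start from $x_0\in\Omega$; at iteration $k$, stop if $x_k$ is stationary; otherwise choose $d_k\in\mathcal{A}(x_k,-\nabla f(x_k))$ and set $x_{k+1}=x_k+\alpha_kd_k$, where $\alpha_k\in[0,\alpha_k^{\max}]$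 and $\alpha_k^{\max}>0$ is such that $x_k+\alpha d_k\in\Omega$ for all $\alpha\in[0,\alpha_k^{\max}]$. *)

theory Defs
  imports "HOL-Analysis.Analysis"
begin

text \<open>The vector in this description is unique wherever \<open>f\<close> is differentiable.\<close>

definition gradient :: "(real ^ 'n \<Rightarrow> real) \<Rightarrow> real ^ 'n \<Rightarrow> real ^ 'n" where
  "gradient f x = (THE D. GDERIV f x :> D)"

definition C1_on :: "(real ^ 'n) set \<Rightarrow> (real ^ 'n \<Rightarrow> real) \<Rightarrow> bool" where
  "C1_on \<Omega> f \<longleftrightarrow> (\<exists>U. open U \<and> \<Omega> \<subseteq> U \<and> (\<forall>x\<in>U. f differentiable (at x)) \<and>
      continuous_on U (gradient f))"

definition tangent_cone :: "(real ^ 'n) set \<Rightarrow> real ^ 'n \<Rightarrow> (real ^ 'n) set" where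
  "tangent_cone \<Omega> x = closure {w. \<exists>t>0. x + t *\<^sub>R w \<in> \<Omega>}"

definition proj_norm :: "(real ^ 'n) set \<Rightarrow> real ^ 'n \<Rightarrow> real ^ 'n \<Rightarrow> real" where
  "proj_norm \<Omega> x g = norm (closest_point (tangent_cone \<Omega> x) g)"

definition stationary :: "(real ^ 'n) set \<Rightarrow> (real ^ 'n \<Rightarrow> real) \<Rightarrow> real ^ 'n \<Rightarrow> bool" where
  "stationary \<Omega> f x \<longleftrightarrow> proj_norm \<Omega> x (- gradient f x) = 0"

definition is_method ::
  "(real ^ 'n) set \<Rightarrow> (real ^ 'n \<Rightarrow> real ^ 'n \<Rightarrow> (real ^ 'n) set) \<Rightarrow> bool" where
  "is_method \<Omega> A \<longleftrightarrow> (\<forall>x\<in>\<Omega>. \<forall>g.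
      A x g \<subseteq> (tangent_cone \<Omega> x \<inter> {d. g \<bullet> d > 0}) \<union> {0} \<and>
      (if proj_norm \<Omega> x g = 0 then A x g = {0} else 0 \<notin> A x g \<and> A x g \<noteq> {}))"

text \<open>For a method \<open>A\<close> and \<open>x \<in> \<Omega>\<close>, the infimum in \<open>DSB\<close> ranges over a nonempty set of positive
  reals, so all values of \<open>DSB\<close> are nonnegative; hence for nonempty \<open>\<Omega>\<close> the real-valued infima
  below are the true ones.\<close>

definition DSB ::
  "(real ^ 'n \<Rightarrow> real ^ 'n \<Rightarrow> (real ^ 'n) set) \<Rightarrow> (real ^ 'n) set \<Rightarrow> real ^ 'n \<Rightarrow> real ^ 'n \<Rightarrow> real" where
  "DSB A \<Omega> x g =
    (if proj_norm \<Omega> x g \<noteq> 0 then INF d\<in>A x g. (g \<bullet> d) / (proj_norm \<Omega> x g * norm d) else 1)"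

definition SB ::
  "(real ^ 'n \<Rightarrow> real ^ 'n \<Rightarrow> (real ^ 'n) set) \<Rightarrow> (real ^ 'n) set \<Rightarrow> real" where
  "SB A \<Omega> = (INF (x, g)\<in>\<Omega> \<times> UNIV. DSB A \<Omega> x g)"

text \<open>The sequences describe a run of the method that performs at least \<open>N\<close> iterations, so none of
  the first \<open>N\<close> iterates is stationary.  Entries with larger indices are irrelevant.\<close>

definition first_order_run ::
  "(real ^ 'n) set \<Rightarrow> (real ^ 'n \<Rightarrow> real ^ 'n \<Rightarrow> (real ^ 'n) set) \<Rightarrow> (real ^ 'n \<Rightarrow> real) \<Rightarrow>
   (nat \<Rightarrow> real ^ 'n) \<Rightarrow> (nat \<Rightarrow> real ^ 'n) \<Rightarrow> (nat \<Rightarrow> real) \<Rightarrow> (nat \<Rightarrow> real) \<Rightarrow> nat \<Rightarrow> bool" where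
  "first_order_run \<Omega> A f x d \<alpha> \<alpha>max N \<longleftrightarrow> x 0 \<in> \<Omega> \<and>
    (\<forall>k<N. \<not> stationary \<Omega> f (x k) \<and>
           d k \<in> A (x k) (- gradient f (x k)) \<and>
           \<alpha>max k > 0 \<and> (\<forall>a\<in>{0..\<alpha>max k}. x k + a *\<^sub>R d k \<in> \<Omega>) \<and>
           \<alpha> k \<in> {0..\<alpha>max k} \<and>
           x (Suc k) = x k + \<alpha> k *\<^sub>R d k)"

definition lipschitz_step :: "real \<Rightarrow> (real ^ 'n \<Rightarrow> real) \<Rightarrow> real ^ 'n \<Rightarrow> real ^ 'n \<Rightarrow> real" where
  "lipschitz_step L f x d = ((- gradient f x) \<bullet> d) / (L * (norm d)\<^sup>2)"

end

theory Submission
  imports Defs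
begin

text \<open>
  Write \<open>g\<close> for minus the gradient at the iterate \<open>x\<close>, and \<open>y = x + a d\<close> for the next iterate.
  Everything rests on the quadratic upper bound (\<open>lipschitz_gradient_quadratic_bound\<close>), which turns
  the Lipschitz gradient into
  \<open>f x - f y \<ge> a \<langle>g, d\<rangle> - L/2 a\<^sup>2 \<parallel>d\<parallel>\<^sup>2\<close>.

  (i) The step \<open>a = \<langle>g, d\<rangle> / (L \<parallel>d\<parallel>\<^sup>2)\<close> maximizes the right-hand side, so the decrease is at least
  \<open>(\<langle>g, d\<rangle> / \<parallel>d\<parallel>)\<^sup>2 / (2 L)\<close>.  The angle condition bounds \<open>\<langle>g, d\<rangle> / \<parallel>d\<parallel>\<close> from below by \<open>\<tau>\<close> times the
  norm of the projection of \<open>g\<close> on the tangent cone at \<open>x\<close> (\<open>slope_ge_SB_proj_norm\<close>), and the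
  error bound at \<open>x\<close> compares this norm with the gap \<open>f x - f x\<^sup>*\<close>.

  (ii) For a full Frank-Wolfe step the comparison takes place at the \<^emph>\<open>new\<close> point.  Minimality of
  \<open>y\<close> says that the old \<open>g\<close> is normal to the domain at \<open>y\<close>, so only the change of the gradient, of
  norm at most \<open>L \<parallel>y - x\<parallel>\<close>, survives the projection on the tangent cone at \<open>y\<close>
  (\<open>proj_norm_le_dist_normal\<close>).  Since \<open>a\<close> does not exceed the maximizing step, the decrease is at
  least \<open>L/2 \<parallel>y - x\<parallel>\<^sup>2\<close>.  With the error bound at \<open>y\<close>, the decrease is thus at least \<open>\<mu>/L\<close> times
  the gap at \<open>y\<close>.
\<close>

lemma GDERIV_gradient:
  assumes "f differentiable (at x)"
  shows "GDERIV f x :> gradient f x"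
proof -
  obtain F where F: "(f has_derivative F) (at x)"
    using assms by (auto simp: differentiable_def)
  interpret F: bounded_linear F
    using F by (rule has_derivative_bounded_linear)
  \<comment> \<open>The Riesz representer of a linear functional is the image of \<open>1\<close> under its adjoint.\<close>
  have "(\<lambda>h. h \<bullet> adjoint F 1) = F"
    using adjoint_works[OF F.linear_axioms, of _ 1] by auto
  then have D: "GDERIV f x :> adjoint F 1"
    using F by (simp only: gderiv_def)
  have unique: "E = E'" if "GDERIV f x :> E" "GDERIV f x :> E'" for E E'
  proof -
    have "(\<lambda>h. h \<bullet> E) = (\<lambda>h. h \<bullet> E')"
      using that unfolding gderiv_def by (rule has_derivative_unique)
    then have "\<forall>h. h \<bullet> E = h \<bullet> E'"
      by (simp add: fun_eq_iff)
    then show "E = E'"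
      by (simp add: vector_eq_ldot)
  qed
  show ?thesis
    unfolding gradient_def
    by (rule theI[where P = "\<lambda>E. GDERIV f x :> E", OF D]) (rule unique[OF _ D])
qed

text \<open>
  Along the segment from \<open>x\<close> to \<open>y\<close>, the difference between \<open>f\<close> and the quadratic model has a
  nonpositive derivative, because the gradient changes by at most \<open>L t \<parallel>y - x\<parallel>\<close> at time \<open>t\<close>.
\<close>
lemma lipschitz_gradient_quadratic_bound:
  assumes "convex S" and "C1_on S f" and lip: "L-lipschitz_on S (gradient f)"
    and "x \<in> S" and "y \<in> S"
  shows "f y \<le> f x + gradient f x \<bullet> (y - x) + L / 2 * (norm (y - x))\<^sup>2"
proof -
  define v where "v = y - x"
  define p where "p t = x + t *\<^sub>R v" for t
  define \<phi> where "\<phi> t = f (p t) - t * (gradient f x \<bullet> v) - L / 2 * t\<^sup>2 * (norm v)\<^sup>2" for t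
  have p_in: "p t \<in> S" if "0 \<le> t" "t \<le> 1" for t
    using convexD_alt[OF \<open>convex S\<close> \<open>x \<in> S\<close> \<open>y \<in> S\<close> that]
    by (simp add: p_def v_def algebra_simps)
  have "\<phi> 1 \<le> \<phi> 0"
  proof (rule DERIV_nonpos_imp_nonincreasing[where f = \<phi>])
    fix t :: real
    assume t: "0 \<le> t" "t \<le> 1"
    have "f differentiable (at (p t))"
      using \<open>C1_on S f\<close> p_in[OF t] by (auto simp: C1_on_def)
    then have "(f has_derivative (\<lambda>h. h \<bullet> gradient f (p t))) (at (p t))"
      using GDERIV_gradient unfolding gderiv_def by blast
    moreover have "(p has_derivative (\<lambda>h. h *\<^sub>R v)) (at t)"
      unfolding p_def by (auto intro!: derivative_eq_intros)
    ultimately have "((\<lambda>s. f (p s)) has_derivative (\<lambda>h. (h *\<^sub>R v) \<bullet> gradient f (p t))) (at t)"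
      using has_derivative_compose by blast
    moreover have "(\<lambda>h. (h *\<^sub>R v) \<bullet> gradient f (p t)) = (*) (gradient f (p t) \<bullet> v)"
      by (auto simp: inner_commute)
    ultimately have fp: "DERIV (\<lambda>s. f (p s)) t :> gradient f (p t) \<bullet> v"
      by (simp add: has_field_derivative_def)
    have d\<phi>: "DERIV \<phi> t :> gradient f (p t) \<bullet> v - gradient f x \<bullet> v - L * t * (norm v)\<^sup>2"
      unfolding \<phi>_def by (auto intro!: derivative_eq_intros fp)
    have "(gradient f (p t) - gradient f x) \<bullet> v \<le> norm (gradient f (p t) - gradient f x) * norm v"
      by (rule norm_cauchy_schwarz)
    also have "\<dots> \<le> (L * (t * norm v)) * norm v"
      using lipschitz_onD[OF lip p_in[OF t] \<open>x \<in> S\<close>] t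
      by (intro mult_right_mono) (auto simp: dist_norm p_def)
    finally have "gradient f (p t) \<bullet> v - gradient f x \<bullet> v - L * t * (norm v)\<^sup>2 \<le> 0"
      by (simp add: power2_eq_square algebra_simps)
    with d\<phi> show "\<exists>z. DERIV \<phi> t :> z \<and> z \<le> 0"
      by blast
  qed simp
  then show ?thesis
    by (simp add: \<phi>_def p_def v_def)
qed

lemma convex_tangent_cone:
  assumes "convex S" and "x \<in> S"
  shows "convex (tangent_cone S x)"
  unfolding tangent_cone_def
proof (rule convex_closure, rule convexI)
  fix w z and u v :: real
  assume "w \<in> {w. \<exists>t>0. x + t *\<^sub>R w \<in> S}" "z \<in> {w. \<exists>t>0. x + t *\<^sub>R w \<in> S}"
    and uv: "0 \<le> u" "0 \<le> v" "u + v = 1"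
  then obtain s t where st: "s > 0" "x + s *\<^sub>R w \<in> S" "t > 0" "x + t *\<^sub>R z \<in> S"
    by auto
  have shrink: "x + r *\<^sub>R a \<in> S" if "x + q *\<^sub>R a \<in> S" "0 < r" "r \<le> q" for a and q r :: real
    using convexD_alt[OF \<open>convex S\<close> \<open>x \<in> S\<close> that(1), of "r / q"] that(2,3)
    by (simp add: algebra_simps)
  define r where "r = min s t"
  have r: "r > 0" "x + r *\<^sub>R w \<in> S" "x + r *\<^sub>R z \<in> S"
    using st shrink by (auto simp: r_def)
  have "u *\<^sub>R (x + r *\<^sub>R w) + v *\<^sub>R (x + r *\<^sub>R z) \<in> S"
    using r uv by (intro convexD[OF \<open>convex S\<close>])
  also have "u *\<^sub>R (x + r *\<^sub>R w) + v *\<^sub>R (x + r *\<^sub>R z) = x + r *\<^sub>R (u *\<^sub>R w + v *\<^sub>R z)"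
    using uv(3) by (simp add: algebra_simps flip: scaleR_add_left)
  finally show "u *\<^sub>R w + v *\<^sub>R z \<in> {w. \<exists>t>0. x + t *\<^sub>R w \<in> S}"
    using r(1) by blast
qed

lemma zero_in_tangent_cone:
  assumes "x \<in> S"
  shows "0 \<in> tangent_cone S x"
  unfolding tangent_cone_def
  using assms by (intro subsetD[OF closure_subset]) (auto intro: exI[of _ 1])

text \<open>
  If \<open>p\<close> is the projection of \<open>g\<close>, then \<open>\<parallel>p\<parallel>\<^sup>2 \<le> \<langle>g, p\<rangle> \<le> \<langle>g - h, p\<rangle>\<close>: the first inequality compares
  \<open>p\<close> with the point \<open>0\<close> of the tangent cone, and the second holds because \<open>h\<close>, being normal to \<open>S\<close>
  at \<open>x\<close>, has nonpositive inner product with all tangent vectors.  The Cauchy-Schwarz inequality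
  finishes.
\<close>
lemma proj_norm_le_dist_normal:
  assumes "convex S" and "x \<in> S" and normal: "\<And>z. z \<in> S \<Longrightarrow> h \<bullet> (z - x) \<le> 0"
  shows "proj_norm S x g \<le> norm (g - h)"
proof -
  define p where "p = closest_point (tangent_cone S x) g"
  have closed: "closed (tangent_cone S x)"
    by (simp add: tangent_cone_def)
  have zero: "0 \<in> tangent_cone S x"
    using \<open>x \<in> S\<close> by (rule zero_in_tangent_cone)
  have "p \<in> tangent_cone S x"
    using closed zero unfolding p_def by (intro closest_point_in_set) auto
  moreover have "tangent_cone S x \<subseteq> {w. h \<bullet> w \<le> 0}"
    unfolding tangent_cone_def
  proof (rule closure_minimal)
    show "{w. \<exists>t>0. x + t *\<^sub>R w \<in> S} \<subseteq> {w. h \<bullet> w \<le> 0}"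
      using normal by (force simp: mult_le_0_iff)
  qed (rule closed_halfspace_le)
  ultimately have hp: "h \<bullet> p \<le> 0"
    by auto
  have "(g - p) \<bullet> (0 - p) \<le> 0"
    unfolding p_def
    by (rule closest_point_dot[OF convex_tangent_cone[OF \<open>convex S\<close> \<open>x \<in> S\<close>] closed zero])
  then have "norm p * norm p \<le> (g - h) \<bullet> p"
    using hp by (simp add: inner_diff_left flip: power2_eq_square power2_norm_eq_inner)
  also have "\<dots> \<le> norm (g - h) * norm p"
    by (rule norm_cauchy_schwarz)
  finally have "norm p \<le> norm (g - h)"
    by (cases "p = 0") auto
  then show ?thesis
    by (simp add: proj_norm_def p_def)
qed

text \<open>
  The infima in \<open>DSB\<close> and \<open>SB\<close> are infima of reals, so each of them needs a lower bound (here \<open>0\<close>)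
  before it can be compared with the values it ranges over.
\<close>
lemma slope_ge_SB_proj_norm:
  assumes meth: "is_method S A" and "x \<in> S" and nz: "proj_norm S x g \<noteq> 0" and "d \<in> A x g"
  shows "d \<noteq> 0" and "0 < g \<bullet> d" and "SB A S * proj_norm S x g \<le> (g \<bullet> d) / norm d"
proof -
  have pos: "e \<noteq> 0 \<and> 0 < h \<bullet> e" if "y \<in> S" "proj_norm S y h \<noteq> 0" "e \<in> A y h" for y h e
    using meth that unfolding is_method_def by (auto split: if_splits)
  have ratio: "0 \<le> (h \<bullet> e) / (proj_norm S y h * norm e)"
    if "y \<in> S" "proj_norm S y h \<noteq> 0" "e \<in> A y h" for y h e
    using pos[OF that] by (simp add: proj_norm_def)
  have "0 \<le> DSB A S y h" if "y \<in> S" for y h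
  proof (cases "proj_norm S y h = 0")
    case False
    then have "A y h \<noteq> {}"
      using meth \<open>y \<in> S\<close> by (auto simp: is_method_def)
    then show ?thesis
      using False ratio[OF \<open>y \<in> S\<close> False] by (auto simp: DSB_def intro: cINF_greatest)
  qed (simp add: DSB_def)
  then have "bdd_below ((\<lambda>(x, g). DSB A S x g) ` (S \<times> UNIV))"
    by (intro bdd_belowI[of _ 0]) auto
  then have "SB A S \<le> DSB A S x g"
    unfolding SB_def using \<open>x \<in> S\<close> by (intro cINF_lower2[of _ _ "(x, g)"]) auto
  also have "\<dots> \<le> (g \<bullet> d) / (proj_norm S x g * norm d)"
    using nz \<open>d \<in> A x g\<close> ratio[OF \<open>x \<in> S\<close> nz]
    by (auto simp: DSB_def intro!: cINF_lower bdd_belowI2[of _ 0])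
  finally have le: "SB A S \<le> (g \<bullet> d) / (proj_norm S x g * norm d)" .
  show "d \<noteq> 0" "0 < g \<bullet> d"
    using pos[OF \<open>x \<in> S\<close> nz \<open>d \<in> A x g\<close>] by auto
  have "0 < proj_norm S x g"
    using nz by (simp add: proj_norm_def)
  then show "SB A S * proj_norm S x g \<le> (g \<bullet> d) / norm d"
    using le \<open>d \<noteq> 0\<close> by (simp add: field_simps)
qed

lemma first_order_run_in_domain:
  assumes "first_order_run S A f x d \<alpha> \<alpha>max N" and "k \<le> N"
  shows "x k \<in> S"
  using assms by (cases k) (auto simp: first_order_run_def Suc_le_eq)

theorem proposition3p2:
  fixes \<Omega> :: "(real ^ 'n) set"
    and f :: "real ^ 'n \<Rightarrow> real"
    and A :: "real ^ 'n \<Rightarrow> real ^ 'n \<Rightarrow> (real ^ 'n) set"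
    and x d :: "nat \<Rightarrow> real ^ 'n"
    and \<alpha> \<alpha>max :: "nat \<Rightarrow> real"
    and xstar :: "real ^ 'n"
    and L \<tau> \<mu> :: real
    and k N :: nat
  assumes "compact \<Omega>" and "convex \<Omega>"
    and "C1_on \<Omega> f"
    and "L > 0" and "L-lipschitz_on \<Omega> (gradient f)"
    and "is_method \<Omega> A"
    and "SB A \<Omega> = \<tau>" and "\<tau> > 0"
    and "first_order_run \<Omega> A f x d \<alpha> \<alpha>max N" and "k < N"
    and "\<alpha> k = min (lipschitz_step L f (x k) (d k)) (\<alpha>max k)"
    and "\<mu> > 0"
    and "xstar \<in> \<Omega>" and "stationary \<Omega> f xstar"
    and "\<forall>y\<in>{x k, x (Suc k)}. f y \<ge> f xstar \<and>
           proj_norm \<Omega> y (- gradient f y) \<ge> sqrt (2 * \<mu>) * sqrt (f y - f xstar)"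
  shows "(\<alpha> k = lipschitz_step L f (x k) (d k) \<longrightarrow>
            f (x (Suc k)) - f xstar \<le> (1 - \<mu> / L * \<tau>\<^sup>2) * (f (x k) - f xstar)) \<and>
         (is_arg_min (\<lambda>z. gradient f (x k) \<bullet> z) (\<lambda>z. z \<in> \<Omega>) (x (Suc k)) \<longrightarrow>
            f (x (Suc k)) - f xstar \<le> inverse (1 + \<mu> / L) * (f (x k) - f xstar))"
proof -
  let ?y = "x (Suc k)"
  let ?a = "lipschitz_step L f (x k) (d k)"
  define g where "g = - gradient f (x k)"
  have xin: "x k \<in> \<Omega>" and yin: "?y \<in> \<Omega>"
    using first_order_run_in_domain[OF assms(9)] \<open>k < N\<close> by auto
  have nonstat: "proj_norm \<Omega> (x k) g \<noteq> 0" and dk: "d k \<in> A (x k) g"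
    and \<alpha>0: "0 \<le> \<alpha> k" and y: "?y = x k + \<alpha> k *\<^sub>R d k"
    using assms(9) \<open>k < N\<close> by (auto simp: first_order_run_def stationary_def g_def)
  have d0: "d k \<noteq> 0" and slope: "\<tau> * proj_norm \<Omega> (x k) g \<le> (g \<bullet> d k) / norm (d k)"
    using slope_ge_SB_proj_norm[OF \<open>is_method \<Omega> A\<close> xin nonstat dk] \<open>SB A \<Omega> = \<tau>\<close> by auto
  have a: "?a * (L * (norm (d k))\<^sup>2) = g \<bullet> d k"
    using d0 \<open>L > 0\<close> by (simp add: lipschitz_step_def g_def)
  have decrease: "\<alpha> k * (g \<bullet> d k) - L / 2 * (\<alpha> k)\<^sup>2 * (norm (d k))\<^sup>2 \<le> f (x k) - f ?y"
    using lipschitz_gradient_quadratic_bound[OF assms(2,3,5) xin yin]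
    by (simp add: y g_def power_mult_distrib)
  have error_bound: "2 * \<mu> * (f z - f xstar) \<le> (proj_norm \<Omega> z (- gradient f z))\<^sup>2"
    if "z \<in> {x k, ?y}" for z
  proof -
    have "0 \<le> f z - f xstar"
      and le: "sqrt (2 * \<mu>) * sqrt (f z - f xstar) \<le> proj_norm \<Omega> z (- gradient f z)"
      using assms(15) that by auto
    then have "2 * \<mu> * (f z - f xstar) = (sqrt (2 * \<mu>) * sqrt (f z - f xstar))\<^sup>2"
      using \<open>\<mu> > 0\<close> by (simp add: power_mult_distrib)
    also have "\<dots> \<le> (proj_norm \<Omega> z (- gradient f z))\<^sup>2"
      using le \<open>0 \<le> f z - f xstar\<close> \<open>\<mu> > 0\<close> by (intro power_mono) auto
    finally show ?thesis .
  qed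
  have "f ?y - f xstar \<le> (1 - \<mu> / L * \<tau>\<^sup>2) * (f (x k) - f xstar)" if "\<alpha> k = ?a"
  proof -
    have "\<tau>\<^sup>2 * (2 * \<mu> * (f (x k) - f xstar)) \<le> \<tau>\<^sup>2 * (proj_norm \<Omega> (x k) g)\<^sup>2"
      using error_bound[of "x k"] by (intro mult_left_mono) (auto simp: g_def)
    also have "\<dots> = (\<tau> * proj_norm \<Omega> (x k) g)\<^sup>2"
      by (simp add: power_mult_distrib)
    also have "\<dots> \<le> ((g \<bullet> d k) / norm (d k))\<^sup>2"
      using slope \<open>\<tau> > 0\<close> by (intro power_mono) (auto simp: proj_norm_def)
    also have "\<dots> = (L * ?a * norm (d k))\<^sup>2"
      using d0 by (simp add: power2_eq_square flip: a)
    also have "\<dots> = 2 * L * (?a * (?a * (L * (norm (d k))\<^sup>2)) - L / 2 * ?a\<^sup>2 * (norm (d k))\<^sup>2)"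
      by (simp add: power2_eq_square algebra_simps)
    also have "\<dots> \<le> 2 * L * (f (x k) - f ?y)"
      using decrease \<open>L > 0\<close> unfolding that a by (intro mult_left_mono) auto
    finally show ?thesis
      using \<open>L > 0\<close> by (simp add: field_simps)
  qed
  moreover have "f ?y - f xstar \<le> inverse (1 + \<mu> / L) * (f (x k) - f xstar)"
    if "is_arg_min (\<lambda>z. gradient f (x k) \<bullet> z) (\<lambda>z. z \<in> \<Omega>) ?y"
  proof -
    have "g \<bullet> (z - ?y) \<le> 0" if "z \<in> \<Omega>" for z
      using \<open>is_arg_min _ _ ?y\<close> that by (force simp: is_arg_min_def g_def inner_diff_right)
    then have "proj_norm \<Omega> ?y (- gradient f ?y) \<le> norm (- gradient f ?y - g)"
      by (rule proj_norm_le_dist_normal[OF \<open>convex \<Omega>\<close> yin])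
    also have "\<dots> = dist (gradient f ?y) (gradient f (x k))"
      by (simp add: g_def dist_norm norm_minus_commute)
    also have "\<dots> \<le> L * (\<alpha> k * norm (d k))"
      using lipschitz_onD[OF assms(5) yin xin] \<alpha>0 by (simp add: y dist_norm)
    finally have "(proj_norm \<Omega> ?y (- gradient f ?y))\<^sup>2 \<le> (L * (\<alpha> k * norm (d k)))\<^sup>2"
      by (intro power_mono) (auto simp: proj_norm_def)
    with error_bound[of ?y] have "2 * \<mu> * (f ?y - f xstar) \<le> (L * (\<alpha> k * norm (d k)))\<^sup>2"
      by simp
    also have "\<dots> = 2 * L * (\<alpha> k * (\<alpha> k * (L * (norm (d k))\<^sup>2)) - L / 2 * (\<alpha> k)\<^sup>2 * (norm (d k))\<^sup>2)"
      by (simp add: power2_eq_square algebra_simps)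
    also have "\<dots> \<le> 2 * L * (\<alpha> k * (?a * (L * (norm (d k))\<^sup>2)) - L / 2 * (\<alpha> k)\<^sup>2 * (norm (d k))\<^sup>2)"
      using assms(11) \<alpha>0 \<open>L > 0\<close>
      by (intro mult_left_mono diff_right_mono mult_right_mono) auto
    also have "\<dots> \<le> 2 * L * (f (x k) - f ?y)"
      using decrease \<open>L > 0\<close> unfolding a by (intro mult_left_mono) auto
    finally have "(L + \<mu>) * (f ?y - f xstar) \<le> L * (f (x k) - f xstar)"
      by (simp add: algebra_simps)
    moreover have "inverse (1 + \<mu> / L) = L / (L + \<mu>)"
      using \<open>L > 0\<close> \<open>\<mu> > 0\<close> by (simp add: field_simps)
    ultimately show ?thesis
      using \<open>L > 0\<close> \<open>\<mu> > 0\<close> by (simp add: field_simps)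
  qed
  ultimately show ?thesis
    by blast
qed

end
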